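(* Let $\omega\in\mathbb R$ and let $f:\mathbb R\to\mathbb R$ satisfy (h1)--(h4) below, with asymptotic slope $l$. Let $L=-\Delta-\omega$ on $\ell^2(\mathbb Z^2)$, so that $\sigma(L)=[-\omega,8-\omega]$, and assume that $0\notin\sigma(L)$ and $l\notin\sigma(L)$; if $\omega<0$, assume also that $l>-\omega$. Then for every pair of integers $k_1,k_2>1$ the equation $$-\Delta u_{n,m}-\omega u_{n,m}=f(u_{n,m}),\qquad (n,m)\in\mathbb Z^2,$$ admits a nontrivial $(k_1,k_2)$-periodic ground state solution $u^{(k_1,k_2)}\in X_{k_1,k_2}$. If, in addition, $f$ is odd, then the set of $(k_1,k_2)$-periodic ground states contains a pair of solutions $\pm u^{(k_1,k_2)}$, and a $(k_1,k_2)$-periodic ground state can be chosen which is nonnegative (i.e. $u_{n,m}\ge 0$ for all $(n,m)$).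
   Context: Discrete Laplacian: $(\Delta u)_{n,m}=u_{n+1,m}+u_{n-1,m}+u_{n,m+1}+u_{n,m-1}-4u_{n,m}$. All sequences are real-valued. Assumptions on $f$, with $F(t)=\int_0^t f(s)\,ds$: (h1) $f(t)=o(t)$ as $t\to0$; (h2) $\lim_{t\to\pm\infty} f(t)/t=l<\infty$ (the same finite limit $l$ at both ends); (h3) $f\in C^1(\mathbb R)$ and $f(t)t<f'(t)t^2$ for all $t\ne0$; (h4) $\frac12 f(t)t-F(t)\to\infty$ as $t\to\pm\infty$. Periodic setting: for integers $k_1,k_2>1$, $Q_{k_1,k_2}=\{(n,m)\in\mathbb Z^2: -[k_1/2]\le n\le k_1-[k_1/2]-1,\ -[k_2/2]\le m\le k_2-[k_2/2]-1\}$, where $[\cdot]$ is the integer part. $X_{k_1,k_2}$ is the finite-dimensional space of real sequences on $\mathbb Z^2$ that are $k_1$-periodic in $n$ and $k_2$-periodic in $m$, with inner product $(u,v)_{k_1,k_2}=\sum_{(n,m)\in Q_{k_1,k_2}}u_{n,m}v_{n,m}$ and norm $\|u\|_{k_1,k_2}=(u,u)_{k_1,k_2}^{1/2}$. The formula $L=-\Delta-\omega$ is also used for the operator on $X_{k_1,k_2}$. Put $$J_{k_1,k_2}(u)=\tfrac12(Lu,u)_{k_1,k_2}-\sum_{(n,m)\in Q_{k_1,k_2}}F(u_{n,m}),$$ $$\mathcal N_{k_1,k_2}=\{u\in X_{k_1,k_2}\setminus\{0\}:\langle J_{k_1,k_2}'(u),u\rangle=0\}.$$ A $(k_1,k_2)$-periodic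 ground state is a minimizer of $J_{k_1,k_2}$ on $\mathcal N_{k_1,k_2}$; a ground state solution is a ground state that solves the equation.
   Formalization: The formal theorem adds the assumption ω ≤ 8; for ω > 8 the claim is false, since (Lu,u) < 0 while Σ f(u)u > 0 for every nonzero periodic u (e.g. ω = 9, f(t) = t³/(1+t²), l = 1), so no nontrivial periodic solution exists. *)

theory Defs
  imports "HOL-Analysis.Analysis" "HOL-Library.Landau_Symbols"
begin

type_synonym lattice_seq = "int \<times> int \<Rightarrow> real"

definition laplacian :: "lattice_seq \<Rightarrow> lattice_seq" where
  "laplacian u = (\<lambda>(n, m). u (n + 1, m) + u (n - 1, m) + u (n, m + 1) + u (n, m - 1) - 4 * u (n, m))"

definition L_op :: "real \<Rightarrow> lattice_seq \<Rightarrow> lattice_seq" where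
  "L_op \<omega> u = (\<lambda>p. - laplacian u p - \<omega> * u p)"

definition ell2 :: "lattice_seq set" where
  "ell2 = {u. (\<lambda>p. (u p)\<^sup>2) summable_on UNIV}"

definition ell2_norm :: "lattice_seq \<Rightarrow> real" where
  "ell2_norm u = sqrt (\<Sum>\<^sub>\<infinity>p. (u p)\<^sup>2)"

text \<open>The real points of the resolvent set and of the spectrum of an operator on real
  \<open>ell2\<close>; for a self-adjoint operator such as \<open>L_op \<omega>\<close> the spectrum of the complexification
  is real, so nothing is lost. The inequality is the boundedness of the inverse, written in terms
  of the preimage \<open>u\<close>.\<close>

definition ell2_resolvent_set :: "(lattice_seq \<Rightarrow> lattice_seq) \<Rightarrow> real set" where
  "ell2_resolvent_set T = {z.
     bij_betw (\<lambda>u p. T u p - z * u p) ell2 ell2 \<and>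
     (\<exists>C. \<forall>u\<in>ell2. ell2_norm u \<le> C * ell2_norm (\<lambda>p. T u p - z * u p))}"

definition ell2_spectrum :: "(lattice_seq \<Rightarrow> lattice_seq) \<Rightarrow> real set" where
  "ell2_spectrum T = - ell2_resolvent_set T"

text \<open>The interval integral is oriented, so this is also right for negative \<open>t\<close>.\<close>

definition primitive :: "(real \<Rightarrow> real) \<Rightarrow> real \<Rightarrow> real" where
  "primitive f t = (LBINT s=0..t. f s)"

definition Q_cell :: "int \<Rightarrow> int \<Rightarrow> (int \<times> int) set" where
  "Q_cell k1 k2 = {(n, m). - (k1 div 2) \<le> n \<and> n \<le> k1 - k1 div 2 - 1 \<and>
                           - (k2 div 2) \<le> m \<and> m \<le> k2 - k2 div 2 - 1}"

definition X_per :: "int \<Rightarrow> int \<Rightarrow> lattice_seq set" where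
  "X_per k1 k2 = {u. \<forall>n m. u (n + k1, m) = u (n, m) \<and> u (n, m + k2) = u (n, m)}"

definition inner_per :: "int \<Rightarrow> int \<Rightarrow> lattice_seq \<Rightarrow> lattice_seq \<Rightarrow> real" where
  "inner_per k1 k2 u v = (\<Sum>p\<in>Q_cell k1 k2. u p * v p)"

definition J_per :: "(real \<Rightarrow> real) \<Rightarrow> real \<Rightarrow> int \<Rightarrow> int \<Rightarrow> lattice_seq \<Rightarrow> real" where
  "J_per f \<omega> k1 k2 u =
     1 / 2 * inner_per k1 k2 (L_op \<omega> u) u - (\<Sum>p\<in>Q_cell k1 k2. primitive f (u p))"

text \<open>The pairing of \<open>J'(u)\<close> with \<open>v\<close>, as the directional derivative of \<open>J\<close> at \<open>u\<close> along \<open>v\<close>.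
  For continuous \<open>f\<close> the functional is continuously differentiable on the finite-dimensional space
  \<open>X_per k1 k2\<close>, so this is the Frechet derivative applied to \<open>v\<close>.\<close>

definition J_per_deriv ::
  "(real \<Rightarrow> real) \<Rightarrow> real \<Rightarrow> int \<Rightarrow> int \<Rightarrow> lattice_seq \<Rightarrow> lattice_seq \<Rightarrow> real" where
  "J_per_deriv f \<omega> k1 k2 u v = deriv (\<lambda>s. J_per f \<omega> k1 k2 (\<lambda>p. u p + s * v p)) 0"

definition Nehari_per :: "(real \<Rightarrow> real) \<Rightarrow> real \<Rightarrow> int \<Rightarrow> int \<Rightarrow> lattice_seq set" where
  "Nehari_per f \<omega> k1 k2 = {u \<in> X_per k1 k2 - {\<lambda>_. 0}. J_per_deriv f \<omega> k1 k2 u u = 0}"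

definition ground_state_per :: "(real \<Rightarrow> real) \<Rightarrow> real \<Rightarrow> int \<Rightarrow> int \<Rightarrow> lattice_seq \<Rightarrow> bool" where
  "ground_state_per f \<omega> k1 k2 u \<longleftrightarrow>
     is_arg_min (J_per f \<omega> k1 k2) (\<lambda>v. v \<in> Nehari_per f \<omega> k1 k2) u"

definition solves_dnls :: "(real \<Rightarrow> real) \<Rightarrow> real \<Rightarrow> lattice_seq \<Rightarrow> bool" where
  "solves_dnls f \<omega> u \<longleftrightarrow>
     (\<forall>n m. - laplacian u (n, m) - \<omega> * u (n, m) = f (u (n, m)))"

definition ground_state_solution_per ::
  "(real \<Rightarrow> real) \<Rightarrow> real \<Rightarrow> int \<Rightarrow> int \<Rightarrow> lattice_seq \<Rightarrow> bool" where
  "ground_state_solution_per f \<omega> k1 k2 u \<longleftrightarrow>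
     ground_state_per f \<omega> k1 k2 u \<and> solves_dnls f \<omega> u"

lemma pos_if_superlinear:
  fixes f :: "real \<Rightarrow> real"
  assumes h1: "f \<in> o[at 0](\<lambda>t. t)"
    and diff: "\<And>t. f differentiable at t"
    and h3: "\<And>t. t \<noteq> 0 \<Longrightarrow> f t * t < deriv f t * t\<^sup>2"
    and "t > 0"
  shows "f t > 0"
proof -
  have der: "((\<lambda>t. f t / t) has_real_derivative (deriv f x * x - f x) / x\<^sup>2) (at x)" if "x > 0" for x
  proof -
    have "(f has_real_derivative deriv f x) (at x)"
      using diff DERIV_deriv_iff_real_differentiable by blast
    then show ?thesis
      using that by (auto intro!: derivative_eq_intros simp: power2_eq_square)
  qed
  have pos: "(deriv f x * x - f x) / x\<^sup>2 > 0" if "x > 0" for x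
    using h3[of x] that by (simp add: power2_eq_square)
  have mono: "f x / x < f y / y" if "0 < x" "x < y" for x y
  proof (rule DERIV_pos_imp_increasing[OF that(2)])
    fix z assume "x \<le> z" "z \<le> y"
    then have "z > 0" using that by simp
    then show "\<exists>d. ((\<lambda>t. f t / t) has_real_derivative d) (at z) \<and> d > 0"
      using der pos by blast
  qed
  have "((\<lambda>t. f t / t) \<longlongrightarrow> 0) (at_right 0)"
    using smalloD_tendsto[OF h1] by (simp add: filterlim_at_split)
  moreover have "eventually (\<lambda>s. f s / s \<le> f (t / 2) / (t / 2)) (at_right 0)"
    using mono[of _ "t / 2"] \<open>t > 0\<close>
    by (intro eventually_at_rightI[of 0 "t / 2"]) (auto intro: less_imp_le)
  ultimately have "0 \<le> f (t / 2) / (t / 2)"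
    by (intro tendsto_le[OF _ tendsto_const, of "at_right 0"]) auto
  also have "\<dots> < f t / t" using \<open>t > 0\<close> by (intro mono) auto
  finally show ?thesis using \<open>t > 0\<close> by (simp add: zero_less_divide_iff)
qed

text \<open>For \<open>\<omega> > 8\<close> the operator \<open>L_op \<omega>\<close> is negative definite while \<open>f t * t > 0\<close> for all nonzero
  \<open>t\<close>, so the equation has no nontrivial periodic solution; any existence result under these
  hypotheses has to exclude \<open>\<omega> > 8\<close>.\<close>

lemma no_periodic_solution_if_omega_gt_8:
  fixes f :: "real \<Rightarrow> real"
  assumes h1: "f \<in> o[at 0](\<lambda>t. t)"
    and diff: "\<And>t. f differentiable at t"
    and h3: "\<And>t. t \<noteq> 0 \<Longrightarrow> f t * t < deriv f t * t\<^sup>2"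
    and \<omega>: "\<omega> > 8"
    and k: "k1 > 1" "k2 > 1"
    and u: "u \<in> X_per k1 k2" "solves_dnls f \<omega> u"
  shows "u = (\<lambda>_. 0)"
proof -
  have fpos: "f t * t > 0" if "t \<noteq> 0" for t
  proof (cases "t > 0")
    case True
    have "f t > 0" by (rule pos_if_superlinear) (fact h1, fact diff, fact h3, fact True)
    then show ?thesis using True by simp
  next
    case False
    define g where "g = (\<lambda>t. - f (- t))"
    have gder: "(g has_real_derivative deriv f (- s)) (at s)" for s
    proof -
      have "(f has_real_derivative deriv f (- s)) (at (- s))"
        using diff DERIV_deriv_iff_real_differentiable by blast
      then have "((\<lambda>s. f (- s)) has_real_derivative - deriv f (- s)) (at s)"
        by (simp add: DERIV_mirror)
      from DERIV_minus[OF this] show ?thesis by (simp add: g_def)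
    qed
    have "((\<lambda>t. f t / t) \<longlongrightarrow> 0) (at 0)" using smalloD_tendsto[OF h1] .
    moreover have "filterlim (uminus :: real \<Rightarrow> real) (at 0) (at 0)"
      by (auto simp: filterlim_at eventually_at_filter intro!: tendsto_eq_intros)
    ultimately have "((\<lambda>t. f (- t) / (- t)) \<longlongrightarrow> 0) (at 0)"
      by (rule filterlim_compose)
    then have "((\<lambda>t. g t / t) \<longlongrightarrow> 0) (at 0)" by (simp add: g_def)
    then have g1: "g \<in> o[at 0](\<lambda>t. t)"
      by (intro smalloI_tendsto) (auto simp: eventually_at_filter)
    have gdiff: "\<And>s. g differentiable at s"
      using gder real_differentiable_def by blast
    have g3: "g s * s < deriv g s * s\<^sup>2" if "s \<noteq> 0" for s
      using h3[of "- s"] that DERIV_imp_deriv[OF gder[of s]] by (simp add: g_def)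
    have neg: "- t > 0" using False that by linarith
    have "g (- t) > 0"
      by (rule pos_if_superlinear) (fact g1, fact gdiff, fact g3, fact neg)
    then show ?thesis using False that by (simp add: g_def mult_neg_neg)
  qed
  define R where "R = {0..<k1} \<times> {0..<k2}"
  have per1: "u (n + j * k1, m) = u (n, m)" for n m j
  proof (induction j rule: int_induct[where k = 0])
    case (step1 i)
    have "u (n + i * k1 + k1, m) = u (n + i * k1, m)"
      using u(1) by (auto simp: X_per_def)
    then show ?case using step1 by (simp add: algebra_simps)
  next
    case (step2 i)
    have "u (n + (i - 1) * k1 + k1, m) = u (n + (i - 1) * k1, m)"
      using u(1) by (auto simp: X_per_def)
    then show ?case using step2 by (simp add: algebra_simps)
  qed simp
  have per2: "u (n, m + j * k2) = u (n, m)" for n m j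
  proof (induction j rule: int_induct[where k = 0])
    case (step1 i)
    have "u (n, m + i * k2 + k2) = u (n, m + i * k2)"
      using u(1) by (auto simp: X_per_def)
    then show ?case using step1 by (simp add: algebra_simps)
  next
    case (step2 i)
    have "u (n, m + (i - 1) * k2 + k2) = u (n, m + (i - 1) * k2)"
      using u(1) by (auto simp: X_per_def)
    then show ?case using step2 by (simp add: algebra_simps)
  qed simp
  have red: "u (n, m) = u (n mod k1, m mod k2)" for n m
    using per1[of "n mod k1" "n div k1" m] per2[of "n mod k1" "m mod k2" "m div k2"]
    by simp
  have "finite R" "R \<noteq> {}" using k by (auto simp: R_def)
  then have "Max ((\<lambda>q. \<bar>u q\<bar>) ` R) \<in> (\<lambda>q. \<bar>u q\<bar>) ` R" by simp
  then obtain p where p: "p \<in> R" "Max ((\<lambda>q. \<bar>u q\<bar>) ` R) = \<bar>u p\<bar>" by blast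
  have max: "\<bar>u q\<bar> \<le> \<bar>u p\<bar>" for q
  proof -
    obtain n m where q: "q = (n, m)" by force
    have "(n mod k1, m mod k2) \<in> R" using k by (auto simp: R_def)
    then have "\<bar>u (n mod k1, m mod k2)\<bar> \<le> Max ((\<lambda>q. \<bar>u q\<bar>) ` R)"
      using \<open>finite R\<close> by (intro Max_ge) auto
    then show ?thesis using p(2) red[of n m] q by simp
  qed
  obtain n m where nm: "p = (n, m)" by force
  have "u p = 0"
  proof (rule ccontr)
    assume nz: "u p \<noteq> 0"
    have b: "- (u q * u p) \<le> (u p)\<^sup>2" for q
    proof -
      have "\<bar>u q * u p\<bar> \<le> \<bar>u p\<bar> * \<bar>u p\<bar>"
        unfolding abs_mult by (intro mult_right_mono max) auto
      then show ?thesis by (auto simp: power2_eq_square abs_le_iff)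
    qed
    have "f (u p) * u p = (- laplacian u p - \<omega> * u p) * u p"
      using u(2) by (simp add: solves_dnls_def nm)
    also have "\<dots> = - (u (n + 1, m) * u p) + - (u (n - 1, m) * u p) + - (u (n, m + 1) * u p)
        + - (u (n, m - 1) * u p) + 4 * (u p)\<^sup>2 - \<omega> * (u p)\<^sup>2"
      by (simp add: laplacian_def nm algebra_simps power2_eq_square)
    also have "\<dots> \<le> (8 - \<omega>) * (u p)\<^sup>2"
      using b[of "(n + 1, m)"] b[of "(n - 1, m)"] b[of "(n, m + 1)"] b[of "(n, m - 1)"]
      by (simp add: algebra_simps)
    also have "\<dots> < 0" using \<omega> nz by (simp add: mult_neg_pos)
    finally show False using fpos[OF nz] by simp
  qed
  then show ?thesis using max by auto
qed

end

theory Submission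
  imports Defs
begin

text \<open>Truncations of the generalised eigenfunction \<open>cos (\<theta> n + \<phi>) cos (\<theta> m + \<phi>)\<close> with
  \<open>4 - 4 cos \<theta> = \<omega>\<close> show that \<open>0\<close> lies in the spectrum whenever \<open>0 \<le> \<omega> \<le> 8\<close>; hence \<open>\<omega> < 0\<close> and
  \<open>L\<close> is positive definite on periodic sequences. Since \<open>f (t x) x / t\<close> increases in \<open>t > 0\<close>, a ray
  meets the Nehari set at most once, at the maximum of \<open>J\<close> on it. On the Nehari set \<open>J u\<close> equals the
  finite sum of \<open>1/2 f(u) u - F(u)\<close>, which is coercive by (h4), while (h1) keeps the set away
  from \<open>0\<close>; so a minimiser exists by compactness. A minimiser is a critical point because a step
  against the gradient, projected back to the Nehari set, would lower \<open>J\<close>. For odd \<open>f\<close>, replacing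
  \<open>u\<close> by \<open>\<bar>u\<bar>\<close> and projecting along the ray does not increase \<open>J\<close>.\<close>

section \<open>Zero in the spectrum\<close>

lemma finite_support_ell2:
  assumes "finite F" "\<And>p. p \<notin> F \<Longrightarrow> u p = 0"
  shows "u \<in> ell2" and "ell2_norm u = sqrt (\<Sum>p\<in>F. (u p)\<^sup>2)"
proof -
  have "(\<lambda>p. (u p)\<^sup>2) summable_on UNIV \<longleftrightarrow> (\<lambda>p. (u p)\<^sup>2) summable_on F"
    using assms(2) by (intro summable_on_cong_neutral) auto
  then show "u \<in> ell2" using assms(1) by (simp add: ell2_def)
  have "(\<Sum>\<^sub>\<infinity>p. (u p)\<^sup>2) = (\<Sum>\<^sub>\<infinity>p\<in>F. (u p)\<^sup>2)"
    using assms(2) by (intro infsum_cong_neutral) auto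
  then show "ell2_norm u = sqrt (\<Sum>p\<in>F. (u p)\<^sup>2)"
    using assms(1) by (simp add: ell2_norm_def)
qed

lemma sum_product_box:
  fixes a b :: "'a \<Rightarrow> real"
  shows "(\<Sum>p\<in>A \<times> B. a (fst p) * b (snd p)) = sum a A * sum b B"
  by (simp add: sum.cartesian_product sum_product split_def)

text \<open>The phase is left free so that \<open>0\<close> and \<open>- (pi / 2)\<close> give a
  cosine and a sine window, whose squares add up to 1 at every site of the window.\<close>

definition cos_window :: "real \<Rightarrow> real \<Rightarrow> nat \<Rightarrow> int \<Rightarrow> real" where
  "cos_window \<theta> \<phi> N n = (if 0 \<le> n \<and> n \<le> int N then cos (\<theta> * n + \<phi>) else 0)"

lemma cos_window_bound: "\<bar>cos_window \<theta> \<phi> N n\<bar> \<le> 1"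
  by (simp add: cos_window_def)

text \<open>The addition theorem makes the untruncated cosine satisfy the recurrence exactly, so
  truncation causes errors only next to the two ends of the window.\<close>

lemma cos_window_defect:
  defines "e \<equiv> (\<lambda>\<theta> \<phi> N n. 2 * cos \<theta> * cos_window \<theta> \<phi> N n
                 - cos_window \<theta> \<phi> N (n + 1) - cos_window \<theta> \<phi> N (n - 1))"
  shows "n \<notin> {-1, 0, int N, int N + 1} \<Longrightarrow> e \<theta> \<phi> N n = 0"
    and "(e \<theta> \<phi> N n)\<^sup>2 \<le> 16"
proof -
  have cs: "cos (\<theta> * (n + 1) + \<phi>) + cos (\<theta> * (n - 1) + \<phi>) = 2 * cos \<theta> * cos (\<theta> * n + \<phi>)"
    by (simp add: algebra_simps cos_add cos_diff sin_add sin_diff)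
  assume "n \<notin> {-1, 0, int N, int N + 1}"
  then consider "n < -1" | "n > int N + 1" | "0 < n" "n < int N" by force
  then show "e \<theta> \<phi> N n = 0"
    using cs by cases (simp_all add: e_def cos_window_def)
next
  have "\<bar>2 * cos \<theta> * cos_window \<theta> \<phi> N n\<bar> \<le> 2 * 1 * 1"
    unfolding abs_mult by (intro mult_mono cos_window_bound) auto
  then have "\<bar>e \<theta> \<phi> N n\<bar> \<le> 4"
    using cos_window_bound[of \<theta> \<phi> N "n + 1"] cos_window_bound[of \<theta> \<phi> N "n - 1"]
    unfolding e_def by linarith
  then have "\<bar>e \<theta> \<phi> N n\<bar>\<^sup>2 \<le> 4\<^sup>2" by (intro power_mono) auto
  then show "(e \<theta> \<phi> N n)\<^sup>2 \<le> 16" by simp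
qed

text \<open>For the product \<open>u\<close> of two windows, the norm is the mass \<open>A\<close>
  itself, while \<open>L_op \<omega> u\<close> lives near the edges and its squared norm is at most
  \<open>256 * A\<close>. A bounded inverse thus bounds \<open>A\<close> independently of
  \<open>N\<close>.\<close>

lemma cos_window_mass_bounded:
  assumes C: "\<And>u. u \<in> ell2 \<Longrightarrow> ell2_norm u \<le> C * ell2_norm (L_op \<omega> u)"
    and \<omega>: "\<omega> = 4 - 4 * cos \<theta>"
  shows "(\<Sum>n=0..int N. (cos_window \<theta> \<phi> N n)\<^sup>2) \<le> 256 * C\<^sup>2"
proof -
  define a where "a = cos_window \<theta> \<phi> N"
  define e where "e = (\<lambda>n. 2 * cos \<theta> * a n - a (n + 1) - a (n - 1))"
  \<comment> \<open>One extra site on each side, so that the support of the defect \<open>e\<close>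
    is covered as well.\<close>
  define I where "I = {-1..int N + 1}"
  define A where "A = (\<Sum>n\<in>I. (a n)\<^sup>2)"
  define E where "E = (\<Sum>n\<in>I. (e n)\<^sup>2)"
  define u where "u = (\<lambda>(n, m). a n * a m)"
  have e0: "e n = 0" if "n \<notin> {-1, 0, int N, int N + 1}" for n
    using cos_window_defect(1)[OF that] by (simp add: e_def a_def)
  have e16: "(e n)\<^sup>2 \<le> 16" for n
    using cos_window_defect(2) by (simp add: e_def a_def)
  have a0: "a n = 0" if "n \<notin> I" for n
    using that by (auto simp: a_def cos_window_def I_def)
  have eI: "e n = 0" if "n \<notin> I" for n
    using that by (intro e0) (auto simp: I_def)
  have "E = (\<Sum>n\<in>{-1, 0, int N, int N + 1}. (e n)\<^sup>2)"
    unfolding E_def using e0 by (intro sum.mono_neutral_right) (auto simp: I_def)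
  also have "\<dots> \<le> of_nat (card {-1, 0, int N, int N + 1}) * 16"
    using e16 by (intro sum_bounded_above) auto
  also have "\<dots> \<le> 4 * 16"
    by (intro mult_right_mono) (auto simp: card_insert_if)
  finally have E: "E \<le> 64" by simp
  have A0: "A \<ge> 0" unfolding A_def by (intro sum_nonneg) auto
  have E0: "E \<ge> 0" unfolding E_def by (intro sum_nonneg) auto
  \<comment> \<open>The diagonal coefficient \<open>4 - \<omega>\<close> equals
    \<open>4 * cos \<theta>\<close>, which splits evenly between the two coordinates and leaves
    one-dimensional defects.\<close>
  have Lu: "L_op \<omega> u (n, m) = e n * a m + a n * e m" for n m
    by (simp add: L_op_def laplacian_def u_def e_def \<omega> algebra_simps)
  have fin: "finite (I \<times> I)" by (simp add: I_def)
  have usupp: "u p = 0" if "p \<notin> I \<times> I" for p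
    using that a0 by (cases p) (auto simp: u_def)
  have Lsupp: "L_op \<omega> u p = 0" if "p \<notin> I \<times> I" for p
    using that a0 eI by (cases p) (auto simp: Lu)
  have "(\<Sum>p\<in>I \<times> I. (u p)\<^sup>2) = A * A"
    unfolding A_def sum_product_box[symmetric]
    by (intro sum.cong) (auto simp: u_def power_mult_distrib)
  with A0 have un: "ell2_norm u = A"
    using finite_support_ell2(2)[of "I \<times> I" u] fin usupp by simp
  have u2: "u \<in> ell2"
    by (rule finite_support_ell2(1)[OF fin]) (rule usupp)
  have Ln: "ell2_norm (L_op \<omega> u) = sqrt (\<Sum>p\<in>I \<times> I. (L_op \<omega> u p)\<^sup>2)"
    by (rule finite_support_ell2(2)[OF fin]) (rule Lsupp)
  have "(\<Sum>p\<in>I \<times> I. (L_op \<omega> u p)\<^sup>2)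
      \<le> (\<Sum>p\<in>I \<times> I. 2 * ((e (fst p))\<^sup>2 * (a (snd p))\<^sup>2) + 2 * ((a (fst p))\<^sup>2 * (e (snd p))\<^sup>2))"
  proof (intro sum_mono)
    fix p :: "int \<times> int"
    obtain n m where p: "p = (n, m)" by force
    show "(L_op \<omega> u p)\<^sup>2 \<le> 2 * ((e (fst p))\<^sup>2 * (a (snd p))\<^sup>2) + 2 * ((a (fst p))\<^sup>2 * (e (snd p))\<^sup>2)"
      using zero_le_power2[of "e n * a m - a n * e m"]
      by (simp add: p Lu power2_eq_square algebra_simps)
  qed
  also have "\<dots> = 2 * (E * A) + 2 * (A * E)"
    unfolding A_def E_def sum.distrib sum_distrib_left[symmetric]
      sum_product_box[of "\<lambda>n. (e n)\<^sup>2" "\<lambda>n. (a n)\<^sup>2"]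
      sum_product_box[of "\<lambda>n. (a n)\<^sup>2" "\<lambda>n. (e n)\<^sup>2"] ..
  also have "\<dots> \<le> 256 * A"
    using mult_right_mono[OF E A0] by (simp add: mult.commute)
  finally have le: "(\<Sum>p\<in>I \<times> I. (L_op \<omega> u p)\<^sup>2) \<le> 256 * A" .
  have "A \<le> C * sqrt (\<Sum>p\<in>I \<times> I. (L_op \<omega> u p)\<^sup>2)"
    using C[OF u2] un Ln by simp
  then have "A\<^sup>2 \<le> (C * sqrt (\<Sum>p\<in>I \<times> I. (L_op \<omega> u p)\<^sup>2))\<^sup>2"
    using A0 by (intro power_mono)
  also have "\<dots> = C\<^sup>2 * (\<Sum>p\<in>I \<times> I. (L_op \<omega> u p)\<^sup>2)"
    by (simp add: power_mult_distrib sum_nonneg)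
  also have "\<dots> \<le> C\<^sup>2 * (256 * A)"
    by (intro mult_left_mono le) auto
  finally have "A * A \<le> (256 * C\<^sup>2) * A" by (simp add: power2_eq_square)
  then have "A \<le> 256 * C\<^sup>2"
    using A0 by (cases "A = 0") (auto simp: mult_le_cancel_right)
  moreover have "A = (\<Sum>n=0..int N. (a n)\<^sup>2)"
    unfolding A_def by (intro sum.mono_neutral_right) (auto simp: I_def a_def cos_window_def)
  ultimately show ?thesis by (simp add: a_def)
qed

lemma zero_in_spectrum_L_op:
  assumes "0 \<le> \<omega>" "\<omega> \<le> 8"
  shows "0 \<in> ell2_spectrum (L_op \<omega>)"
proof (rule ccontr)
  assume "0 \<notin> ell2_spectrum (L_op \<omega>)"
  then obtain C where C: "\<And>u. u \<in> ell2 \<Longrightarrow> ell2_norm u \<le> C * ell2_norm (L_op \<omega> u)"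
    by (auto simp: ell2_spectrum_def ell2_resolvent_set_def)
  define \<theta> where "\<theta> = arccos (1 - \<omega> / 4)"
  have \<omega>: "\<omega> = 4 - 4 * cos \<theta>"
    using assms by (simp add: \<theta>_def)
  obtain N :: nat where N: "real N > 512 * C\<^sup>2" using reals_Archimedean2 by blast
  \<comment> \<open>Cosine and sine squared sum to 1 at each of the \<open>N + 1\<close> sites,
    while both masses stay below \<open>256 * C\<^sup>2\<close>.\<close>
  have "real N + 1 = (\<Sum>n=0..int N. (cos_window \<theta> 0 N n)\<^sup>2 + (cos_window \<theta> (- (pi / 2)) N n)\<^sup>2)"
    by (simp add: cos_window_def cos_diff)
  also have "\<dots> \<le> 256 * C\<^sup>2 + 256 * C\<^sup>2"
    unfolding sum.distrib by (intro add_mono cos_window_mass_bounded[OF C \<omega>])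
  finally show False using N by simp
qed

section \<open>Periodic sequences\<close>

text \<open>The representative of a site in the cell: shifting by half a period before and after
  \<open>mod\<close> moves the residues from \<open>0..<k\<close> to the centred range.\<close>

definition per_rep :: "int \<Rightarrow> int \<Rightarrow> int \<times> int \<Rightarrow> int \<times> int" where
  "per_rep k1 k2 = (\<lambda>(n, m). ((n + k1 div 2) mod k1 - k1 div 2, (m + k2 div 2) mod k2 - k2 div 2))"

lemma periodic_int:
  fixes g :: "int \<Rightarrow> 'a"
  assumes "\<And>n. g (n + k) = g n"
  shows "g (n + j * k) = g n"
proof (induction j rule: int_induct[where k = 0])
  case (step1 i)
  then show ?case using assms[of "n + i * k"] by (simp add: algebra_simps)
next
  case (step2 i)
  then show ?case using assms[of "n + (i - 1) * k"] by (simp add: algebra_simps)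
qed simp

lemma per_rep_in_Q_cell: "k1 > 0 \<Longrightarrow> k2 > 0 \<Longrightarrow> per_rep k1 k2 p \<in> Q_cell k1 k2"
  using pos_mod_bound[of k1 "fst p + k1 div 2"] pos_mod_bound[of k2 "snd p + k2 div 2"]
  by (auto simp: per_rep_def Q_cell_def split: prod.splits)

lemma X_per_per_rep:
  assumes "u \<in> X_per k1 k2"
  shows "u (per_rep k1 k2 p) = u p"
proof -
  obtain n m where p: "p = (n, m)" by force
  have mod_shift: "(x + c) mod k - c = x + (- ((x + c) div k)) * k" for x c k :: int
    using mult_div_mod_eq[of k "x + c"] by (simp add: algebra_simps)
  have "u (n + j * k1, m') = u (n, m')" for j m'
    using periodic_int[of "\<lambda>n. u (n, m')"] assms by (simp add: X_per_def)
  moreover have "u (n', m + j * k2) = u (n', m)" for j n'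
    using periodic_int[of "\<lambda>m. u (n', m)"] assms by (simp add: X_per_def)
  ultimately show ?thesis
    by (simp only: p per_rep_def prod.case mod_shift)
qed

lemma Q_cell_eq_Times:
  "Q_cell k1 k2 = {- (k1 div 2)..<- (k1 div 2) + k1} \<times> {- (k2 div 2)..<- (k2 div 2) + k2}"
  by (auto simp: Q_cell_def)

lemma finite_Q_cell [simp]: "finite (Q_cell k1 k2)"
  by (simp add: Q_cell_eq_Times)

lemma X_per_eq_zero:
  assumes "u \<in> X_per k1 k2" "k1 > 0" "k2 > 0" "\<And>p. p \<in> Q_cell k1 k2 \<Longrightarrow> u p = 0"
  shows "u p = 0"
  using assms X_per_per_rep per_rep_in_Q_cell by metis

section \<open>Summation by parts over one period cell\<close>

lemma sum_shift_periodic: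
  fixes g :: "int \<Rightarrow> real"
  assumes "\<And>n. g (n + k) = g n" "k > 0"
  shows "(\<Sum>n\<in>{a..<a + k}. g (n + 1)) = (\<Sum>n\<in>{a..<a + k}. g n)"
proof -
  have "(\<Sum>n\<in>{a..<a + k}. g (n + 1)) = (\<Sum>n\<in>{a + 1..<a + k + 1}. g n)"
    by (rule sum.reindex_bij_witness[of _ "\<lambda>n. n - 1" "\<lambda>n. n + 1"]) auto
  also have "{a + 1..<a + k + 1} = insert (a + k) {a + 1..<a + k}" using assms(2) by auto
  also have "sum g \<dots> = g a + sum g {a + 1..<a + k}" using assms(1) by simp
  also have "\<dots> = sum g (insert a {a + 1..<a + k})" by simp
  also have "insert a {a + 1..<a + k} = {a..<a + k}" using assms(2) by auto
  finally show ?thesis .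
qed

lemma X_per_shift:
  "u \<in> X_per k1 k2 \<Longrightarrow> (\<lambda>(n, m). u (n + i, m + j)) \<in> X_per k1 k2"
  by (auto simp: X_per_def algebra_simps) (metis add.assoc add.commute)+

lemma sum_Q_cell_shift:
  assumes "u \<in> X_per k1 k2" "k1 > 0" "k2 > 0"
  shows "(\<Sum>(n, m)\<in>Q_cell k1 k2. u (n + 1, m)) = (\<Sum>p\<in>Q_cell k1 k2. u p)"
    and "(\<Sum>(n, m)\<in>Q_cell k1 k2. u (n, m + 1)) = (\<Sum>p\<in>Q_cell k1 k2. u p)"
proof -
  let ?I = "{- (k1 div 2)..<- (k1 div 2) + k1}" and ?J = "{- (k2 div 2)..<- (k2 div 2) + k2}"
  have Q: "(\<Sum>p\<in>Q_cell k1 k2. u p) = (\<Sum>n\<in>?I. \<Sum>m\<in>?J. u (n, m))"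
    by (simp add: Q_cell_eq_Times sum.cartesian_product)
  have "(\<Sum>(n, m)\<in>Q_cell k1 k2. u (n + 1, m)) = (\<Sum>m\<in>?J. \<Sum>n\<in>?I. u (n + 1, m))"
    unfolding Q_cell_eq_Times by (subst sum.swap) (simp add: sum.cartesian_product)
  also have "\<dots> = (\<Sum>m\<in>?J. \<Sum>n\<in>?I. u (n, m))"
    using assms by (intro sum.cong sum_shift_periodic refl) (auto simp: X_per_def)
  also have "\<dots> = (\<Sum>n\<in>?I. \<Sum>m\<in>?J. u (n, m))" by (rule sum.swap)
  finally show "(\<Sum>(n, m)\<in>Q_cell k1 k2. u (n + 1, m)) = (\<Sum>p\<in>Q_cell k1 k2. u p)"
    unfolding Q .
  have "(\<Sum>(n, m)\<in>Q_cell k1 k2. u (n, m + 1)) = (\<Sum>n\<in>?I. \<Sum>m\<in>?J. u (n, m + 1))"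
    by (simp add: Q_cell_eq_Times sum.cartesian_product)
  also have "\<dots> = (\<Sum>n\<in>?I. \<Sum>m\<in>?J. u (n, m))"
    using assms by (intro sum.cong sum_shift_periodic refl) (auto simp: X_per_def)
  finally show "(\<Sum>(n, m)\<in>Q_cell k1 k2. u (n, m + 1)) = (\<Sum>p\<in>Q_cell k1 k2. u p)"
    unfolding Q .
qed

text \<open>The product of \<open>u\<close> with the backward shift of \<open>v\<close> is periodic,
  so its sum over the cell is shift invariant and no boundary terms appear.\<close>

lemma inner_per_shift_adjoint:
  assumes u: "u \<in> X_per k1 k2" and v: "v \<in> X_per k1 k2" and k: "k1 > 0" "k2 > 0"
  shows "inner_per k1 k2 (\<lambda>(n, m). u (n + 1, m)) v = inner_per k1 k2 u (\<lambda>(n, m). v (n - 1, m))"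
    and "inner_per k1 k2 (\<lambda>(n, m). u (n, m + 1)) v = inner_per k1 k2 u (\<lambda>(n, m). v (n, m - 1))"
proof -
  have v': "v (n + k1 - 1, m) = v (n - 1, m)" "v (n, m + k2 - 1) = v (n, m - 1)" for n m
    using v[unfolded X_per_def, simplified, rule_format, of "n - 1" m]
      v[unfolded X_per_def, simplified, rule_format, of n "m - 1"]
    by (simp_all add: algebra_simps)
  have "(\<lambda>(n, m). u (n, m) * v (n - 1, m)) \<in> X_per k1 k2"
    using u v v' by (auto simp: X_per_def)
  from sum_Q_cell_shift(1)[OF this k]
  show "inner_per k1 k2 (\<lambda>(n, m). u (n + 1, m)) v = inner_per k1 k2 u (\<lambda>(n, m). v (n - 1, m))"
    by (simp add: inner_per_def split_def)
  have "(\<lambda>(n, m). u (n, m) * v (n, m - 1)) \<in> X_per k1 k2"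
    using u v v' by (auto simp: X_per_def)
  from sum_Q_cell_shift(2)[OF this k]
  show "inner_per k1 k2 (\<lambda>(n, m). u (n, m + 1)) v = inner_per k1 k2 u (\<lambda>(n, m). v (n, m - 1))"
    by (simp add: inner_per_def split_def)
qed

lemma inner_per_commute: "inner_per k1 k2 u v = inner_per k1 k2 v u"
  by (simp add: inner_per_def mult.commute)

text \<open>Forward shifts are moved to the other factor, so that only backward shifts remain and
  the symmetry in \<open>u\<close> and \<open>v\<close> can be read off.\<close>

lemma inner_per_L_op_expand:
  assumes "u \<in> X_per k1 k2" "v \<in> X_per k1 k2" "k1 > 0" "k2 > 0"
  shows "inner_per k1 k2 (L_op \<omega> u) v = (4 - \<omega>) * inner_per k1 k2 u v
     - inner_per k1 k2 u (\<lambda>(n, m). v (n - 1, m)) - inner_per k1 k2 v (\<lambda>(n, m). u (n - 1, m))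
     - inner_per k1 k2 u (\<lambda>(n, m). v (n, m - 1)) - inner_per k1 k2 v (\<lambda>(n, m). u (n, m - 1))"
proof -
  have "inner_per k1 k2 (L_op \<omega> u) v = (4 - \<omega>) * inner_per k1 k2 u v
     - inner_per k1 k2 (\<lambda>(n, m). u (n + 1, m)) v - inner_per k1 k2 (\<lambda>(n, m). u (n - 1, m)) v
     - inner_per k1 k2 (\<lambda>(n, m). u (n, m + 1)) v - inner_per k1 k2 (\<lambda>(n, m). u (n, m - 1)) v"
    by (simp add: inner_per_def L_op_def laplacian_def split_def algebra_simps
        sum.distrib sum_subtractf sum_distrib_left)
  then show ?thesis
    unfolding inner_per_shift_adjoint[OF assms]
    by (simp add: inner_per_commute[of _ _ v])
qed

lemma inner_per_L_op_symmetric: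
  assumes "u \<in> X_per k1 k2" "v \<in> X_per k1 k2" "k1 > 0" "k2 > 0"
  shows "inner_per k1 k2 (L_op \<omega> u) v = inner_per k1 k2 (L_op \<omega> v) u"
  using inner_per_L_op_expand[OF assms] inner_per_L_op_expand[OF assms(2,1,3,4)]
  by (simp add: inner_per_commute)

text \<open>The negative Laplacian is nonnegative: shifts preserve the norm, so each cross term is
  bounded by \<open>inner_per k1 k2 u u\<close> via
  \<open>2xy \<le> x\<^sup>2 + y\<^sup>2\<close>.\<close>

lemma inner_per_L_op_lower:
  assumes u: "u \<in> X_per k1 k2" and k: "k1 > 0" "k2 > 0"
  shows "inner_per k1 k2 (L_op \<omega> u) u \<ge> - \<omega> * inner_per k1 k2 u u"
proof -
  have sh: "(\<lambda>(n, m). u (n - 1, m)) \<in> X_per k1 k2" "(\<lambda>(n, m). u (n, m - 1)) \<in> X_per k1 k2"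
    using X_per_shift[OF u, of "-1" 0] X_per_shift[OF u, of 0 "-1"] by simp_all
  have n1: "inner_per k1 k2 (\<lambda>(n, m). u (n - 1, m)) (\<lambda>(n, m). u (n - 1, m)) = inner_per k1 k2 u u"
    using inner_per_shift_adjoint(1)[OF sh(1) u k] by simp
  have n2: "inner_per k1 k2 (\<lambda>(n, m). u (n, m - 1)) (\<lambda>(n, m). u (n, m - 1)) = inner_per k1 k2 u u"
    using inner_per_shift_adjoint(2)[OF sh(2) u k] by simp
  have am: "2 * inner_per k1 k2 u w \<le> inner_per k1 k2 u u + inner_per k1 k2 w w" for w
    unfolding inner_per_def sum_distrib_left sum.distrib[symmetric]
    using sum_squares_bound by (intro sum_mono) (simp add: power2_eq_square mult.assoc)
  show ?thesis
    using am[of "\<lambda>(n, m). u (n - 1, m)"] am[of "\<lambda>(n, m). u (n, m - 1)"]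
    unfolding inner_per_L_op_expand[OF u u k] n1 n2 by (simp add: algebra_simps)
qed

lemma L_op_in_X_per: "u \<in> X_per k1 k2 \<Longrightarrow> L_op \<omega> u \<in> X_per k1 k2"
proof -
  assume u: "u \<in> X_per k1 k2"
  have "u (n + k1 - 1, m) = u (n - 1, m)" "u (n, m + k2 - 1) = u (n, m - 1)"
    "u (n + k1 + 1, m) = u (n + 1, m)" "u (n, m + k2 + 1) = u (n, m + 1)" for n m
    using u[unfolded X_per_def, simplified, rule_format, of "n - 1" m]
      u[unfolded X_per_def, simplified, rule_format, of n "m - 1"]
      u[unfolded X_per_def, simplified, rule_format, of "n + 1" m]
      u[unfolded X_per_def, simplified, rule_format, of n "m + 1"]
    by (simp_all add: algebra_simps)
  with u show ?thesis by (simp add: X_per_def L_op_def laplacian_def)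
qed

lemma L_op_linear: "L_op \<omega> (\<lambda>q. a * u q + b * v q) p = a * L_op \<omega> u p + b * L_op \<omega> v p"
  by (cases p) (simp add: L_op_def laplacian_def algebra_simps)

lemma X_per_linear:
  "u \<in> X_per k1 k2 \<Longrightarrow> v \<in> X_per k1 k2 \<Longrightarrow> (\<lambda>q. a * u q + b * v q) \<in> X_per k1 k2"
  by (simp add: X_per_def)

text \<open>The diagonal term is unchanged by taking absolute values, and the neighbours enter with
  a negative sign, so the comparison holds site by site.\<close>

lemma L_op_abs_le:
  "L_op \<omega> (\<lambda>q. \<bar>u q\<bar>) p * \<bar>u p\<bar> \<le> L_op \<omega> u p * u p"
proof -
  obtain n m where p: "p = (n, m)" by force
  have "\<bar>u q\<bar> * \<bar>u p\<bar> \<ge> u q * u p" for q by (metis abs_ge_self abs_mult)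
  from this[of "(n + 1, m)"] this[of "(n - 1, m)"] this[of "(n, m + 1)"] this[of "(n, m - 1)"]
  show ?thesis
    by (simp add: p L_op_def laplacian_def algebra_simps)
qed

lemma continuous_on_L_op:
  assumes "\<And>q. continuous_on A (\<lambda>x. U x q)"
  shows "continuous_on A (\<lambda>x. L_op \<omega> (U x) p)"
  unfolding L_op_def laplacian_def split_def by (intro continuous_intros assms)

section \<open>Minimisation on the Nehari set\<close>

text \<open>Closed form of \<open>J_per_deriv\<close> for periodic arguments, as
  \<open>J_per_deriv_eq\<close> shows; its linearity in \<open>v\<close> and its continuity are
  visible.\<close>

definition dJ_per ::
  "(real \<Rightarrow> real) \<Rightarrow> real \<Rightarrow> int \<Rightarrow> int \<Rightarrow> lattice_seq \<Rightarrow> lattice_seq \<Rightarrow> real" where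
  "dJ_per f \<omega> k1 k2 u v = inner_per k1 k2 (L_op \<omega> u) v - (\<Sum>p\<in>Q_cell k1 k2. f (u p) * v p)"

text \<open>The spectral assumption appears here as \<open>\<omega> < 0\<close>. The bottom
  \<open>- \<omega>\<close> of the spectrum then lies strictly between the slope 0 of
  \<open>f\<close> at the origin and the slope \<open>l\<close> at infinity.\<close>

locale periodic_dnls =
  fixes f :: "real \<Rightarrow> real" and \<omega> l :: real and k1 k2 :: int
  assumes f_smallo: "((\<lambda>t. f t / t) \<longlongrightarrow> 0) (at 0)"
    and f_ratio_top: "((\<lambda>t. f t / t) \<longlongrightarrow> l) at_top"
    and f_diff: "\<And>t. f differentiable at t"
    and f_superlinear: "\<And>t. t \<noteq> 0 \<Longrightarrow> f t * t < deriv f t * t\<^sup>2"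
    and H_top: "filterlim (\<lambda>t. 1 / 2 * f t * t - primitive f t) at_top at_top"
    and H_bot: "filterlim (\<lambda>t. 1 / 2 * f t * t - primitive f t) at_top at_bot"
    and omega_neg: "\<omega> < 0"
    and slope_gt: "l > - \<omega>"
    and k_pos: "k1 > 0" "k2 > 0"
begin

abbreviation "X \<equiv> X_per k1 k2"
abbreviation "Q \<equiv> Q_cell k1 k2"
abbreviation "J \<equiv> J_per f \<omega> k1 k2"
abbreviation "dJ \<equiv> dJ_per f \<omega> k1 k2"
abbreviation "N \<equiv> Nehari_per f \<omega> k1 k2"

section \<open>The functional and its derivative\<close>

lemma f_deriv: "(f has_real_derivative deriv f t) (at t)"
  using f_diff DERIV_deriv_iff_real_differentiable by blast

lemma f_cont: "continuous_on A f"
  using f_deriv DERIV_isCont continuous_at_imp_continuous_on by blast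

lemma f_0: "f 0 = 0"
proof -
  have "((\<lambda>t. f t / t * t) \<longlongrightarrow> 0 * 0) (at 0)"
    by (intro tendsto_mult f_smallo tendsto_ident_at)
  moreover have "eventually (\<lambda>t. f t / t * t = f t) (at 0)"
    by (auto simp: eventually_at_filter)
  ultimately have "(f \<longlongrightarrow> 0 * 0) (at 0)"
    by (rule Lim_transform_eventually)
  then have "(f \<longlongrightarrow> 0) (at 0)" by simp
  moreover have "(f \<longlongrightarrow> f 0) (at 0)"
    using f_deriv DERIV_isCont isCont_def by blast
  ultimately show ?thesis using LIM_unique by blast
qed

lemma primitive_deriv: "(primitive f has_real_derivative f t) (at t)"
proof -
  \<comment> \<open>The margin 1 puts \<open>t\<close> in the interior of the interval, so the
    derivative within it is the full derivative.\<close>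
  let ?a = "min 0 t - 1" and ?b = "max 0 t + 1"
  have "((\<lambda>u. LBINT y=ereal 0..ereal u. f y) has_vector_derivative f t) (at t within {?a..?b})"
    by (intro interval_integral_FTC2 f_cont) auto
  moreover have "at t within {?a..?b} = at t"
    by (intro at_within_Icc_at) auto
  ultimately show ?thesis
    unfolding primitive_def[abs_def] has_real_derivative_iff_has_vector_derivative
    by (simp add: zero_ereal_def)
qed

lemma primitive_cont: "continuous_on A (primitive f)"
  using primitive_deriv DERIV_isCont continuous_at_imp_continuous_on by blast

lemma J_line_deriv:
  assumes u: "u \<in> X" and v: "v \<in> X"
  shows "((\<lambda>s. J (\<lambda>p. u p + s * v p)) has_real_derivative dJ (\<lambda>p. u p + s * v p) v) (at s)"
proof -
  define w where "w = (\<lambda>p. u p + s * v p)"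
  have w: "w \<in> X" using X_per_linear[OF u v, of 1 s] by (simp add: w_def)
  have lin: "L_op \<omega> (\<lambda>p. u p + r * v p) p = L_op \<omega> u p + r * L_op \<omega> v p" for r p
    using L_op_linear[of \<omega> 1 u r v p] by simp
  have "((\<lambda>s. J (\<lambda>p. u p + s * v p)) has_real_derivative
      1 / 2 * (\<Sum>p\<in>Q. L_op \<omega> v p * w p + L_op \<omega> w p * v p) - (\<Sum>p\<in>Q. f (w p) * v p)) (at s)"
    unfolding J_per_def inner_per_def w_def lin
    by (auto intro!: derivative_eq_intros DERIV_chain2[OF primitive_deriv] sum.cong
        simp: algebra_simps)
  \<comment> \<open>Symmetry of \<open>L_op \<omega>\<close> merges the two bilinear terms and
    cancels the factor \<open>1 / 2\<close>.\<close>
  also have "(\<Sum>p\<in>Q. L_op \<omega> v p * w p + L_op \<omega> w p * v p) = 2 * inner_per k1 k2 (L_op \<omega> w) v"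
    using inner_per_L_op_symmetric[OF v w k_pos, of \<omega>] by (simp add: inner_per_def sum.distrib)
  finally show ?thesis by (simp add: dJ_per_def w_def)
qed

lemma J_per_deriv_eq: "u \<in> X \<Longrightarrow> v \<in> X \<Longrightarrow> J_per_deriv f \<omega> k1 k2 u v = dJ u v"
  unfolding J_per_deriv_def using DERIV_imp_deriv[OF J_line_deriv[of u v 0]] by simp

lemma Nehari_iff: "u \<in> N \<longleftrightarrow> u \<in> X \<and> u \<noteq> (\<lambda>_. 0) \<and> dJ u u = 0"
  by (auto simp: Nehari_per_def J_per_deriv_eq)

lemma continuous_on_dJ:
  assumes "\<And>q. continuous_on A (\<lambda>x. U x q)" "\<And>q. continuous_on A (\<lambda>x. V x q)"
  shows "continuous_on A (\<lambda>x. dJ (U x) (V x))"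
  unfolding dJ_per_def inner_per_def
  by (intro continuous_intros continuous_on_L_op assms continuous_on_compose2[OF f_cont[of UNIV]])
     auto

lemma continuous_on_J:
  assumes "\<And>q. continuous_on A (\<lambda>x. U x q)"
  shows "continuous_on A (\<lambda>x. J (U x))"
  unfolding J_per_def inner_per_def
  by (intro continuous_intros continuous_on_L_op assms
      continuous_on_compose2[OF primitive_cont[of UNIV]]) auto

lemma zero_if_zero_on_Q: "u \<in> X \<Longrightarrow> (\<And>p. p \<in> Q \<Longrightarrow> u p = 0) \<Longrightarrow> u = (\<lambda>_. 0)"
  using X_per_eq_zero k_pos by blast

lemma inner_per_pos:
  assumes "u \<in> X" "u \<noteq> (\<lambda>_. 0)"
  shows "inner_per k1 k2 u u > 0"
proof -
  obtain p where "p \<in> Q" "u p \<noteq> 0" using zero_if_zero_on_Q assms by blast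
  then show ?thesis
    unfolding inner_per_def by (intro sum_pos2[of _ p]) (auto simp: zero_less_mult_iff)
qed

text \<open>For small entries the nonlinear term takes at most half of the quadratic lower bound
  \<open>- \<omega> * inner_per k1 k2 u u\<close>. Hence every element of the Nehari set has an
  entry of size at least \<open>\<delta>\<close> on the cell.\<close>

lemma dJ_pos_if_small:
  obtains \<delta> where "\<delta> > 0"
    "\<And>u. u \<in> X \<Longrightarrow> u \<noteq> (\<lambda>_. 0) \<Longrightarrow> (\<And>p. p \<in> Q \<Longrightarrow> \<bar>u p\<bar> < \<delta>) \<Longrightarrow> dJ u u > 0"
proof -
  have "eventually (\<lambda>t. f t / t < - \<omega> / 2) (at 0)"
    using order_tendstoD(2)[OF f_smallo, of "- \<omega> / 2"] omega_neg by simp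
  then obtain \<delta> where \<delta>: "\<delta> > 0" "\<And>t. t \<noteq> 0 \<Longrightarrow> \<bar>t\<bar> < \<delta> \<Longrightarrow> f t / t < - \<omega> / 2"
    by (auto simp: eventually_at)
  have fb: "f t * t \<le> - \<omega> / 2 * (t * t)" if "\<bar>t\<bar> < \<delta>" for t
  proof (cases "t = 0")
    case False
    have "f t * t = f t / t * (t * t)" using False by simp
    also have "\<dots> \<le> - \<omega> / 2 * (t * t)"
      using \<delta>(2)[OF False that] by (intro mult_right_mono) auto
    finally show ?thesis .
  qed simp
  have "dJ u u > 0" if u: "u \<in> X" "u \<noteq> (\<lambda>_. 0)" "\<And>p. p \<in> Q \<Longrightarrow> \<bar>u p\<bar> < \<delta>" for u
  proof -
    have "(\<Sum>p\<in>Q. f (u p) * u p) \<le> - \<omega> / 2 * inner_per k1 k2 u u"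
      unfolding inner_per_def sum_distrib_left by (intro sum_mono fb u(3))
    moreover have "- \<omega> / 2 * inner_per k1 k2 u u > 0"
      using inner_per_pos[OF u(1,2)] omega_neg by (intro mult_pos_pos) auto
    ultimately show ?thesis
      using inner_per_L_op_lower[OF u(1) k_pos, of \<omega>] by (simp add: dJ_per_def)
  qed
  with \<delta>(1) show thesis using that by blast
qed

section \<open>The functional along rays\<close>

text \<open>For \<open>t > 0\<close> this is the derivative of \<open>J\<close> along the ray
  through \<open>u\<close>, divided by \<open>t\<close>. The division makes the quadratic part
  constant, so monotonicity depends on \<open>f\<close> alone.\<close>

definition fibre_slope :: "lattice_seq \<Rightarrow> real \<Rightarrow> real" where
  "fibre_slope u t = inner_per k1 k2 (L_op \<omega> u) u - (\<Sum>p\<in>Q. f (t * u p) * u p / t)"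

lemma dJ_fibre:
  assumes "t \<noteq> 0"
  shows "dJ (\<lambda>p. t * u p) u = t * fibre_slope u t"
    and "dJ (\<lambda>p. t * u p) (\<lambda>p. t * u p) = t\<^sup>2 * fibre_slope u t"
proof -
  have lin: "L_op \<omega> (\<lambda>p. t * u p) p = t * L_op \<omega> u p" for p
    using L_op_linear[of \<omega> t u 0 u p] by simp
  show *: "dJ (\<lambda>p. t * u p) u = t * fibre_slope u t"
    using assms unfolding dJ_per_def fibre_slope_def inner_per_def lin
    by (simp add: right_diff_distrib sum_distrib_left mult.assoc)
  have "dJ (\<lambda>p. t * u p) (\<lambda>p. t * u p) = t * dJ (\<lambda>p. t * u p) u"
    unfolding dJ_per_def inner_per_def
    by (simp add: right_diff_distrib sum_distrib_left mult.left_commute)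
  then show "dJ (\<lambda>p. t * u p) (\<lambda>p. t * u p) = t\<^sup>2 * fibre_slope u t"
    using * by (simp add: power2_eq_square)
qed

text \<open>Up to a positive factor, the derivative in \<open>r\<close> is the difference of the two
  sides of (h3) at \<open>r * x\<close>, for either sign of \<open>x\<close>.\<close>

lemma fibre_ratio_strict_mono:
  assumes "x \<noteq> 0" "0 < s" "s < t"
  shows "f (s * x) * x / s < f (t * x) * x / t"
proof (rule DERIV_pos_imp_increasing[OF assms(3)])
  fix r assume "s \<le> r" "r \<le> t"
  then have r: "r > 0" using assms by simp
  have "((\<lambda>r. f (r * x) * x / r) has_real_derivative
      (deriv f (r * x) * x * x * r - f (r * x) * x) / r\<^sup>2) (at r)"
    using r by (auto intro!: derivative_eq_intros DERIV_chain2[OF f_deriv] simp: power2_eq_square)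
  moreover have "(deriv f (r * x) * x * x * r - f (r * x) * x) * r > 0"
    using f_superlinear[of "r * x"] r assms(1) by (simp add: power2_eq_square algebra_simps)
  then have "(deriv f (r * x) * x * x * r - f (r * x) * x) / r\<^sup>2 > 0"
    using r by (simp add: zero_less_mult_iff)
  ultimately show "\<exists>y. ((\<lambda>r. f (r * x) * x / r) has_real_derivative y) (at r) \<and> y > 0"
    by blast
qed

lemma fibre_slope_strict_antimono:
  assumes "u \<in> X" "u \<noteq> (\<lambda>_. 0)" "0 < s" "s < t"
  shows "fibre_slope u t < fibre_slope u s"
proof -
  \<comment> \<open>Sites with \<open>u p = 0\<close> contribute nothing to either sum; the site
    \<open>q\<close> makes the inequality strict.\<close>
  obtain q where "q \<in> Q" "u q \<noteq> 0" using zero_if_zero_on_Q assms by blast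
  then have "(\<Sum>p\<in>Q. f (s * u p) * u p / s) < (\<Sum>p\<in>Q. f (t * u p) * u p / t)"
    using fibre_ratio_strict_mono[OF _ assms(3,4)]
    by (intro sum_strict_mono_ex1) (auto, metis less_eq_real_def mult_zero_right div_0)
  then show ?thesis by (simp add: fibre_slope_def)
qed

lemma fibre_slope_1: "fibre_slope u 1 = dJ u u"
  using dJ_fibre(1)[of 1 u] by simp

lemma J_fibre_deriv:
  assumes "u \<in> X" "s > 0"
  shows "((\<lambda>s. J (\<lambda>p. s * u p)) has_real_derivative s * fibre_slope u s) (at s)"
proof -
  have "(\<lambda>_. 0) \<in> X" by (simp add: X_per_def)
  from J_line_deriv[OF this assms(1), of s] show ?thesis
    using dJ_fibre(1)[of s u] assms(2) by simp
qed

text \<open>The slope decreases and vanishes at 1, so \<open>J\<close> rises along the ray up to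
  \<open>u\<close> and falls afterwards.\<close>

lemma J_fibre_le:
  assumes "u \<in> N" "t > 0"
  shows "J (\<lambda>p. t * u p) \<le> J u"
proof -
  have u: "u \<in> X" "u \<noteq> (\<lambda>_. 0)" "fibre_slope u 1 = 0"
    using assms by (auto simp: Nehari_iff fibre_slope_1)
  have "J (\<lambda>p. t * u p) \<le> J (\<lambda>p. 1 * u p)"
  proof (cases "t \<le> 1")
    case True
    show ?thesis
    proof (rule DERIV_nonneg_imp_nondecreasing[OF True, of "\<lambda>s. J (\<lambda>p. s * u p)"])
      fix s assume s: "t \<le> s" "s \<le> 1"
      have "fibre_slope u s \<ge> 0"
        using fibre_slope_strict_antimono[OF u(1,2), of s 1] u(3) s assms(2)
        by (cases "s = 1") auto
      then show "\<exists>y. ((\<lambda>s. J (\<lambda>p. s * u p)) has_real_derivative y) (at s) \<and> 0 \<le> y"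
        using J_fibre_deriv[OF u(1), of s] s assms(2)
        by (intro exI[of _ "s * fibre_slope u s"] conjI) auto
    qed
  next
    case False
    show ?thesis
    proof (rule DERIV_nonpos_imp_nonincreasing[of 1 t "\<lambda>s. J (\<lambda>p. s * u p)"])
      fix s assume s: "1 \<le> s" "s \<le> t"
      have "fibre_slope u s \<le> 0"
        using fibre_slope_strict_antimono[OF u(1,2), of 1 s] u(3) s
        by (cases "s = 1") auto
      then show "\<exists>y. ((\<lambda>s. J (\<lambda>p. s * u p)) has_real_derivative y) (at s) \<and> y \<le> 0"
        using J_fibre_deriv[OF u(1), of s] s
        by (intro exI[of _ "s * fibre_slope u s"] conjI) (auto simp: mult_le_0_iff)
    qed (use False in simp)
  qed
  then show ?thesis by simp
qed

text \<open>The pairing is positive on small multiples of \<open>w\<close> and nonpositive at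
  \<open>w\<close> itself, so the intermediate value theorem gives a crossing.\<close>

lemma Nehari_projection:
  assumes w: "w \<in> X" "w \<noteq> (\<lambda>_. 0)" "dJ w w \<le> 0"
  obtains t where "0 < t" "t \<le> 1" "(\<lambda>p. t * w p) \<in> N"
proof -
  obtain \<delta> where \<delta>: "\<delta> > 0"
    "\<And>u. u \<in> X \<Longrightarrow> u \<noteq> (\<lambda>_. 0) \<Longrightarrow> (\<And>p. p \<in> Q \<Longrightarrow> \<bar>u p\<bar> < \<delta>) \<Longrightarrow> dJ u u > 0"
    using dJ_pos_if_small by blast
  have tw: "(\<lambda>p. t * w p) \<in> X" "t \<noteq> 0 \<Longrightarrow> (\<lambda>p. t * w p) \<noteq> (\<lambda>_. 0)" for t
    using X_per_linear[OF w(1) w(1), of t 0] w(2) by (auto simp: fun_eq_iff)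
  \<comment> \<open>The summand 1 makes the bound on the entries strict and \<open>M\<close>
    positive.\<close>
  define M where "M = (\<Sum>p\<in>Q. \<bar>w p\<bar>) + 1"
  have M: "M > 0" "\<bar>w p\<bar> < M" if "p \<in> Q" for p
    using member_le_sum[of p Q "\<lambda>p. \<bar>w p\<bar>"] that
    by (auto simp: M_def intro!: add_nonneg_pos sum_nonneg)
  have "M > 0" by (auto simp: M_def intro!: add_nonneg_pos sum_nonneg)
  define s where "s = min 1 (\<delta> / M)"
  have s: "0 < s" "s \<le> 1" using \<open>M > 0\<close> \<delta>(1) by (auto simp: s_def)
  have "\<bar>s * w p\<bar> < \<delta>" if "p \<in> Q" for p
  proof -
    have "\<bar>s * w p\<bar> < s * M" unfolding abs_mult using s M(2)[OF that] by simp
    also have "\<dots> \<le> \<delta> / M * M" using \<open>M > 0\<close> by (intro mult_right_mono) (auto simp: s_def)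
    finally show ?thesis using \<open>M > 0\<close> by simp
  qed
  then have pos: "dJ (\<lambda>p. s * w p) (\<lambda>p. s * w p) > 0"
    using tw s(1) by (intro \<delta>(2)) auto
  have "continuous_on {s..1} (\<lambda>t. dJ (\<lambda>p. t * w p) (\<lambda>p. t * w p))"
    by (intro continuous_on_dJ continuous_intros)
  then obtain t where "s \<le> t" "t \<le> 1" "dJ (\<lambda>p. t * w p) (\<lambda>p. t * w p) = 0"
    using IVT2'[of "\<lambda>t. dJ (\<lambda>p. t * w p) (\<lambda>p. t * w p)" 1 0 s] pos w(3) s(2) by auto
  with s(1) tw that[of t] show thesis by (auto simp: Nehari_iff)
qed

text \<open>Large constant sequences lie beyond the Nehari set because \<open>l > - \<omega>\<close>.\<close>

lemma Nehari_nonempty: "N \<noteq> {}"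
proof -
  have "eventually (\<lambda>t. f t / t > - \<omega> \<and> t > 0) at_top"
    using order_tendstoD(1)[OF f_ratio_top slope_gt] eventually_gt_at_top[of 0]
    by eventually_elim auto
  from eventually_happens[OF this] obtain c where c: "f c / c > - \<omega>" "c > 0"
    by auto
  define w :: lattice_seq where "w = (\<lambda>_. c)"
  have "- \<omega> * c * c < f c * c"
    using mult_strict_right_mono[of "- \<omega> * c" "f c" c] c by (simp add: pos_less_divide_eq)
  \<comment> \<open>The Laplacian of a constant vanishes, so each summand is
    \<open>- \<omega> * c * c - f c * c\<close>.\<close>
  then have "dJ w w \<le> 0"
    unfolding dJ_per_def inner_per_def sum_subtractf[symmetric]
    by (intro sum_nonpos) (auto simp: w_def L_op_def laplacian_def)
  moreover have "w \<in> X" "w \<noteq> (\<lambda>_. 0)" using c(2) by (auto simp: w_def X_per_def fun_eq_iff)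
  ultimately show ?thesis using Nehari_projection by blast
qed

section \<open>Coercivity and existence of a minimiser\<close>

text \<open>On the Nehari set the first term drops out, leaving a sum to which (h4) applies entry by
  entry.\<close>

lemma J_eq: "J u = 1 / 2 * dJ u u + (\<Sum>p\<in>Q. 1 / 2 * f (u p) * u p - primitive f (u p))"
  by (simp add: J_per_def dJ_per_def sum_subtractf right_diff_distrib
      sum_distrib_left mult.assoc)

lemma H_large: "\<exists>R. \<forall>t. \<bar>t\<bar> > R \<longrightarrow> 1 / 2 * f t * t - primitive f t > K"
proof -
  have "eventually (\<lambda>t. 1 / 2 * f t * t - primitive f t > K) at_top"
    "eventually (\<lambda>t. 1 / 2 * f t * t - primitive f t > K) at_bot"
    using H_top H_bot unfolding filterlim_at_top_dense by blast+
  then obtain a b where "\<And>t. t \<ge> a \<Longrightarrow> 1 / 2 * f t * t - primitive f t > K"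
    "\<And>t. t \<le> b \<Longrightarrow> 1 / 2 * f t * t - primitive f t > K"
    unfolding eventually_at_top_linorder eventually_at_bot_linorder by blast
  then show ?thesis by (intro exI[of _ "max a (- b)"]) (auto simp: abs_real_def)
qed

lemma H_bounded_below: "\<exists>B \<ge> 0. \<forall>t. 1 / 2 * f t * t - primitive f t \<ge> - B"
proof -
  obtain R where R: "\<And>t. \<bar>t\<bar> > R \<Longrightarrow> 1 / 2 * f t * t - primitive f t > 0"
    using H_large by blast
  have "continuous_on {- R..R} (\<lambda>t. 1 / 2 * f t * t - primitive f t)"
    by (intro continuous_intros f_cont primitive_cont)
  then have "bounded ((\<lambda>t. 1 / 2 * f t * t - primitive f t) ` {- R..R})"
    by (intro compact_imp_bounded compact_continuous_image) auto
  then obtain B where B: "\<forall>t\<in>{- R..R}. \<bar>1 / 2 * f t * t - primitive f t\<bar> \<le> B"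
    unfolding bounded_iff by auto
  \<comment> \<open>The absolute value covers an empty interval, for which \<open>B\<close> may be
    negative.\<close>
  have "1 / 2 * f t * t - primitive f t \<ge> - \<bar>B\<bar>" for t
  proof (cases "\<bar>t\<bar> > R")
    case True
    then show ?thesis using R[of t] by linarith
  next
    case False
    then have "\<bar>1 / 2 * f t * t - primitive f t\<bar> \<le> B"
      by (intro bspec[OF B]) (auto simp: abs_le_iff)
    then show ?thesis by linarith
  qed
  then show ?thesis by (intro exI[of _ "\<bar>B\<bar>"]) auto
qed

text \<open>One large entry makes its own summand exceed \<open>c + card Q * B\<close>, and the
  other summands cannot compensate since each is at least \<open>- B\<close>. Periodicity extends
  the bound from the cell to all sites.\<close>

lemma Nehari_sublevel_bounded:
  "\<exists>R. \<forall>u\<in>N. J u \<le> c \<longrightarrow> (\<forall>p. \<bar>u p\<bar> \<le> R)"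
proof -
  let ?H = "\<lambda>t. 1 / 2 * f t * t - primitive f t"
  obtain B where B: "B \<ge> 0" "\<And>t. ?H t \<ge> - B" using H_bounded_below by blast
  obtain R where R: "\<And>t. \<bar>t\<bar> > R \<Longrightarrow> ?H t > c + of_nat (card Q) * B"
    using H_large by blast
  have "\<bar>u p\<bar> \<le> R" if u: "u \<in> N" "J u \<le> c" for u p
  proof -
    have uX: "u \<in> X" and dJ0: "dJ u u = 0" using u(1) by (auto simp: Nehari_iff)
    define q where "q = per_rep k1 k2 p"
    have q: "q \<in> Q" "u q = u p"
      using X_per_per_rep[OF uX] per_rep_in_Q_cell k_pos by (auto simp: q_def)
    have "- (of_nat (card Q) * B) \<le> (\<Sum>p\<in>Q - {q}. - B)"
      using B(1) card_mono[of Q "Q - {q}"] by (auto intro!: mult_right_mono)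
    also have "\<dots> \<le> (\<Sum>p\<in>Q - {q}. ?H (u p))" by (intro sum_mono B(2))
    also have "\<dots> = J u - ?H (u q)"
      using q(1) by (simp add: J_eq dJ0 sum.remove[of Q q])
    finally have "\<not> ?H (u q) > c + of_nat (card Q) * B" using u(2) by linarith
    then show ?thesis using R[of "u p"] q(2) by force
  qed
  then show ?thesis by blast
qed

text \<open>Lattice sequences carry the product topology, so this is Tychonoff's theorem; it allows
  minimising without coordinates on \<open>X\<close>.\<close>

lemma compact_box: "compact {u :: lattice_seq. \<forall>p. \<bar>u p\<bar> \<le> R}"
proof -
  have "{u :: lattice_seq. \<forall>p. \<bar>u p\<bar> \<le> R} = PiE UNIV (\<lambda>_. {- R..R})"
    by (auto simp: PiE_def Pi_def abs_le_iff minus_le_iff)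
  moreover have "compactin (product_topology (\<lambda>_. euclidean) UNIV)
      (PiE (UNIV :: (int \<times> int) set) (\<lambda>_. {- R..R}))"
    unfolding compactin_PiE by simp
  ultimately show ?thesis by (simp add: euclidean_product_topology)
qed

lemma closed_X: "closed X"
proof -
  have "X = (\<Inter>n m. {u. u (n + k1, m) = u (n, m)} \<inter> {u. u (n, m + k2) = u (n, m)})"
    by (auto simp: X_per_def)
  then show ?thesis by (auto intro!: closed_INT closed_Int closed_Collect_eq)
qed

lemma ground_state_exists: "\<exists>u. ground_state_per f \<omega> k1 k2 u"
proof -
  obtain \<delta> where \<delta>: "\<delta> > 0"
    "\<And>u. u \<in> X \<Longrightarrow> u \<noteq> (\<lambda>_. 0) \<Longrightarrow> (\<And>p. p \<in> Q \<Longrightarrow> \<bar>u p\<bar> < \<delta>) \<Longrightarrow> dJ u u > 0"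
    using dJ_pos_if_small by blast
  obtain w where w: "w \<in> N" using Nehari_nonempty by blast
  obtain R where R: "\<And>u p. u \<in> N \<Longrightarrow> J u \<le> J w \<Longrightarrow> \<bar>u p\<bar> \<le> R"
    using Nehari_sublevel_bounded by metis
  \<comment> \<open>The union over \<open>Q\<close> replaces the condition
    \<open>u \<noteq> 0\<close> by a closed one; by the choice of \<open>\<delta>\<close> no element
    of the sublevel set is lost.\<close>
  define S where "S = {u. \<forall>p. \<bar>u p\<bar> \<le> R} \<inter>
    (X \<inter> {u. dJ u u = 0} \<inter> (\<Union>p\<in>Q. {u. \<delta> \<le> \<bar>u p\<bar>}))"
  have "compact S"
    unfolding S_def
    by (intro compact_Int_closed compact_box closed_Int closed_X closed_UN closed_Collect_eq
        closed_Collect_le continuous_on_dJ continuous_intros finite_Q_cell ballI) auto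
  have SN: "u \<in> N" if "u \<in> S" for u
    using that \<delta>(1) by (auto simp: S_def Nehari_iff)
  have NS: "u \<in> S" if "u \<in> N" "J u \<le> J w" for u
    using that R[OF that] \<delta>(2)[of u] by (force simp: S_def Nehari_iff)
  have "continuous_on S J"
    by (intro continuous_on_J continuous_on_subset[OF continuous_on_product_coordinates]) auto
  then obtain u where u: "u \<in> S" "\<And>v. v \<in> S \<Longrightarrow> J u \<le> J v"
    using continuous_attains_inf[OF \<open>compact S\<close>] NS[OF w] by blast
  \<comment> \<open>If \<open>J v\<close> exceeds \<open>J w\<close>, the comparison goes through
    \<open>w\<close>, which lies in \<open>S\<close>.\<close>
  have "J u \<le> J v" if "v \<in> N" for v
    using u(2)[OF NS[OF w]] u(2)[OF NS[OF that]] by linarith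
  then have "ground_state_per f \<omega> k1 k2 u"
    using SN[OF u(1)] by (auto simp: ground_state_per_def is_arg_min_def not_less)
  then show ?thesis by blast
qed

text \<open>The Nehari set is a natural constraint: if \<open>J'\<close> did not vanish at a ground state \<open>u\<close>, a small
  step along \<open>v = - J'(u)\<close>, rescaled back onto the Nehari set, would lower \<open>J\<close> below the maximum of
  \<open>J\<close> on the ray through \<open>u\<close>.\<close>

lemma ground_state_solves:
  assumes gs: "ground_state_per f \<omega> k1 k2 u"
  shows "solves_dnls f \<omega> u"
proof -
  have uN: "u \<in> N" and min: "\<And>w. w \<in> N \<Longrightarrow> J u \<le> J w"
    using gs by (auto simp: ground_state_per_def is_arg_min_def not_less)
  have uX: "u \<in> X" and u0: "u \<noteq> (\<lambda>_. 0)" and uG: "dJ u u = 0"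
    using uN by (auto simp: Nehari_iff)
  define v where "v = (\<lambda>p. f (u p) - L_op \<omega> u p)"
  have vX: "v \<in> X"
    using uX L_op_in_X_per[OF uX, of \<omega>] by (simp add: X_per_def v_def)
  have dv: "dJ u v = - inner_per k1 k2 v v"
    by (simp add: dJ_per_def inner_per_def v_def sum_subtractf[symmetric] sum_negf[symmetric]
        algebra_simps)
  have "v = (\<lambda>_. 0)"
  proof (rule ccontr)
    assume "v \<noteq> (\<lambda>_. 0)"
    then have neg: "dJ u v < 0" using inner_per_pos[OF vX] dv by simp
    define W where "W = (\<lambda>(x :: real \<times> real) p. fst x * u p + snd x * v p)"
    have WX: "W x \<in> X" for x
      using X_per_linear[OF uX vX] by (simp add: W_def)
    \<comment> \<open>Descent in direction \<open>v\<close> persists on a rectangle of parameters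
      around \<open>(1, 0)\<close>.\<close>
    have "continuous_on UNIV (\<lambda>x. dJ (W x) v)"
      unfolding W_def by (intro continuous_on_dJ continuous_intros)
    then have "open {x. dJ (W x) v < 0}"
      by (intro open_Collect_less continuous_on_const)
    moreover have "(1, 0) \<in> {x. dJ (W x) v < 0}" using neg by (simp add: W_def)
    ultimately obtain A B where AB: "open A" "open B" "(1, 0) \<in> A \<times> B"
      "A \<times> B \<subseteq> {x. dJ (W x) v < 0}"
      by (rule open_prod_elim)
    obtain a where a: "a > 0" "cball 1 a \<subseteq> A"
      using AB(1,3) open_contains_cball_eq by blast
    obtain b where b: "b > 0" "cball 0 b \<subseteq> B"
      using AB(2,3) open_contains_cball_eq by blast
    \<comment> \<open>The bound \<open>1 / 2\<close> keeps \<open>1 - \<delta>\<close> positive, so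
      the ray estimates apply.\<close>
    define \<delta> where "\<delta> = min a (1 / 2)"
    have \<delta>: "0 < \<delta>" "\<delta> < 1" using a(1) by (auto simp: \<delta>_def)
    have desc: "dJ (W (t, s)) v < 0" if "1 - \<delta> \<le> t" "t \<le> 1 + \<delta>" "0 \<le> s" "s \<le> b" for t s
    proof -
      have "t \<in> cball 1 a" using that by (auto simp: dist_real_def \<delta>_def)
      moreover have "s \<in> cball 0 b" using that by auto
      ultimately show ?thesis using AB(4) a(2) b(2) by blast
    qed
    have cont: "continuous_on K (\<lambda>s. dJ (W (t, s)) (W (t, s)))"
      "continuous_on K (\<lambda>s. dJ (W (s, t)) (W (s, t)))" for t K
      unfolding W_def by (intro continuous_on_dJ continuous_intros)+
    have W0: "W (t, 0) = (\<lambda>p. t * u p)" for t by (simp add: W_def)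
    \<comment> \<open>The strictly decreasing slope vanishes at 1, so the pairing has opposite signs
      at \<open>1 - \<delta>\<close> and \<open>1 + \<delta>\<close>. Both signs survive a small
      step \<open>s > 0\<close>, and a zero \<open>t\<close> lies between them.\<close>
    have "dJ (W (1 - \<delta>, 0)) (W (1 - \<delta>, 0)) > 0"
      using fibre_slope_strict_antimono[OF uX u0, of "1 - \<delta>" 1] \<delta>
        dJ_fibre(2)[of "1 - \<delta>" u] by (simp add: W0 fibre_slope_1 uG)
    moreover have "((\<lambda>s. dJ (W (1 - \<delta>, s)) (W (1 - \<delta>, s)))
        \<longlongrightarrow> dJ (W (1 - \<delta>, 0)) (W (1 - \<delta>, 0))) (at_right 0)"
      using cont(1)[of UNIV "1 - \<delta>"]
      by (simp add: continuous_on_eq_continuous_at isCont_def filterlim_at_split)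
    ultimately have ev1: "eventually (\<lambda>s. dJ (W (1 - \<delta>, s)) (W (1 - \<delta>, s)) > 0) (at_right 0)"
      using order_tendstoD(1) by blast
    have "dJ (W (1 + \<delta>, 0)) (W (1 + \<delta>, 0)) < 0"
      using fibre_slope_strict_antimono[OF uX u0, of 1 "1 + \<delta>"] \<delta>
        dJ_fibre(2)[of "1 + \<delta>" u] by (simp add: W0 fibre_slope_1 uG mult_pos_neg)
    moreover have "((\<lambda>s. dJ (W (1 + \<delta>, s)) (W (1 + \<delta>, s)))
        \<longlongrightarrow> dJ (W (1 + \<delta>, 0)) (W (1 + \<delta>, 0))) (at_right 0)"
      using cont(1)[of UNIV "1 + \<delta>"]
      by (simp add: continuous_on_eq_continuous_at isCont_def filterlim_at_split)
    ultimately have ev2: "eventually (\<lambda>s. dJ (W (1 + \<delta>, s)) (W (1 + \<delta>, s)) < 0) (at_right 0)"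
      using order_tendstoD(2) by blast
    have "eventually (\<lambda>s. s \<in> {0<..<b}) (at_right 0)"
      using b(1) by (rule eventually_at_right_real)
    with ev1 ev2 have "eventually (\<lambda>s. dJ (W (1 - \<delta>, s)) (W (1 - \<delta>, s)) > 0 \<and>
        dJ (W (1 + \<delta>, s)) (W (1 + \<delta>, s)) < 0 \<and> s \<in> {0<..<b}) (at_right 0)"
      by eventually_elim auto
    from eventually_happens[OF this] obtain s where s: "dJ (W (1 - \<delta>, s)) (W (1 - \<delta>, s)) > 0"
      "dJ (W (1 + \<delta>, s)) (W (1 + \<delta>, s)) < 0" "0 < s" "s < b"
      by auto
    obtain t where t: "1 - \<delta> \<le> t" "t \<le> 1 + \<delta>" "dJ (W (t, s)) (W (t, s)) = 0"
      using IVT2'[of "\<lambda>t. dJ (W (t, s)) (W (t, s))" "1 + \<delta>" 0 "1 - \<delta>"] s(1,2) \<delta>(1) cont(2)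
      by auto
    \<comment> \<open>The pairing with \<open>v\<close> is zero at the zero sequence but negative at
      \<open>W (t, s)\<close>, which is therefore nonzero.\<close>
    have "L_op \<omega> (\<lambda>_. 0) p = 0" for p by (cases p) (simp add: L_op_def laplacian_def)
    then have "dJ (\<lambda>_. 0) v = 0" by (simp add: dJ_per_def inner_per_def f_0)
    then have "W (t, s) \<noteq> (\<lambda>_. 0)" using desc[OF t(1,2), of s] s by auto
    then have "W (t, s) \<in> N" using WX t(3) by (simp add: Nehari_iff)
    then have "J u \<le> J (W (t, s))" by (rule min)
    also have "J (W (t, s)) < J (W (t, 0))"
    proof (rule DERIV_neg_imp_decreasing[OF s(3), of "\<lambda>s. J (W (t, s))"])
      fix r assume r: "0 \<le> r" "r \<le> s"
      have "(\<lambda>p. t * u p) \<in> X" using WX[of "(t, 0)"] by (simp add: W0)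
      from J_line_deriv[OF this vX, of r]
      have "((\<lambda>s. J (W (t, s))) has_real_derivative dJ (W (t, r)) v) (at r)"
        by (simp add: W_def)
      moreover have "dJ (W (t, r)) v < 0" using desc[OF t(1,2), of r] r s by auto
      ultimately show "\<exists>y. ((\<lambda>s. J (W (t, s))) has_real_derivative y) (at r) \<and> y < 0" by blast
    qed
    also have "J (W (t, 0)) \<le> J u"
      unfolding W0 using t(1) \<delta>(2) by (intro J_fibre_le uN) auto
    finally show False by simp
  qed
  then have "L_op \<omega> u p = f (u p)" for p by (metis diff_eq_diff_eq diff_self v_def)
  then show ?thesis by (simp add: solves_dnls_def L_op_def)
qed

subsection \<open>Odd nonlinearities\<close>

context
  assumes odd: "\<And>t. f (- t) = - f t"
begin

lemma primitive_even: "primitive f (- t) = primitive f t"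
proof -
  have "((\<lambda>t. primitive f (- t) - primitive f t) has_real_derivative 0) (at t)" for t
    by (auto intro!: derivative_eq_intros DERIV_chain2[OF primitive_deriv] simp: odd)
  then have "primitive f (- t) - primitive f t = primitive f (- 0) - primitive f 0"
    by (intro DERIV_isconst_all) auto
  then show ?thesis by simp
qed

lemma primitive_abs: "primitive f \<bar>t\<bar> = primitive f t"
  by (simp add: abs_if primitive_even)

lemma f_abs: "f \<bar>t\<bar> * \<bar>t\<bar> = f t * t"
  by (simp add: abs_if odd)

lemma J_uminus: "J (\<lambda>p. - u p) = J u"
  and dJ_uminus: "dJ (\<lambda>p. - u p) (\<lambda>p. - u p) = dJ u u"
proof -
  have "L_op \<omega> (\<lambda>p. - u p) p = - L_op \<omega> u p" for p
    using L_op_linear[of \<omega> "-1" u 0 u p] by simp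
  then show "J (\<lambda>p. - u p) = J u" "dJ (\<lambda>p. - u p) (\<lambda>p. - u p) = dJ u u"
    by (simp_all add: J_per_def dJ_per_def inner_per_def primitive_even odd)
qed

text \<open>For odd \<open>f\<close> the nonlinear sums depend only on absolute values, so only the
  quadratic part changes, and it does not increase.\<close>

lemma J_abs_le: "J (\<lambda>p. \<bar>u p\<bar>) \<le> J u"
  and dJ_abs_le: "dJ (\<lambda>p. \<bar>u p\<bar>) (\<lambda>p. \<bar>u p\<bar>) \<le> dJ u u"
  unfolding J_per_def dJ_per_def inner_per_def primitive_abs f_abs
  by (auto intro!: sum_mono L_op_abs_le)

lemma ground_state_uminus:
  assumes "ground_state_per f \<omega> k1 k2 u"
  shows "ground_state_per f \<omega> k1 k2 (\<lambda>p. - u p)"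
  using assms X_per_linear[of u k1 k2 u "-1" 0]
  by (auto simp: ground_state_per_def is_arg_min_def Nehari_iff J_uminus dJ_uminus fun_eq_iff)

lemma nonneg_ground_state_exists:
  "\<exists>v. ground_state_per f \<omega> k1 k2 v \<and> (\<forall>p. v p \<ge> 0)"
proof -
  obtain u where "ground_state_per f \<omega> k1 k2 u" using ground_state_exists by blast
  then have u: "u \<in> N" and min: "\<And>w. w \<in> N \<Longrightarrow> J u \<le> J w"
    by (auto simp: ground_state_per_def is_arg_min_def not_less)
  have "(\<lambda>p. \<bar>u p\<bar>) \<in> X" "(\<lambda>p. \<bar>u p\<bar>) \<noteq> (\<lambda>_. 0)" "dJ (\<lambda>p. \<bar>u p\<bar>) (\<lambda>p. \<bar>u p\<bar>) \<le> 0"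
    using u dJ_abs_le[of u] by (auto simp: Nehari_iff X_per_def fun_eq_iff)
  then obtain t where t: "0 < t" "(\<lambda>p. t * \<bar>u p\<bar>) \<in> N"
    using Nehari_projection by blast
  \<comment> \<open>The factor \<open>t\<close> projects the absolute value of \<open>u\<close>; the
    comparison passes through \<open>t * u p\<close>, on the ray where \<open>u\<close> is the
    maximum.\<close>
  have "J (\<lambda>p. t * \<bar>u p\<bar>) \<le> J (\<lambda>p. t * u p)"
    using J_abs_le[of "\<lambda>p. t * u p"] t(1) by (simp add: abs_mult)
  also have "\<dots> \<le> J u" by (rule J_fibre_le[OF u t(1)])
  finally have "ground_state_per f \<omega> k1 k2 (\<lambda>p. t * \<bar>u p\<bar>)"
    using t(2) min by (force simp: ground_state_per_def is_arg_min_def not_less)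
  with t(1) show ?thesis by (intro exI[of _ "\<lambda>p. t * \<bar>u p\<bar>"]) auto
qed

end

end

theorem theorem3p1:
  fixes f :: "real \<Rightarrow> real" and \<omega> l :: real and k1 k2 :: int
  assumes h1: "f \<in> o[at 0](\<lambda>t. t)"
    and h2_top: "((\<lambda>t. f t / t) \<longlongrightarrow> l) at_top"
    and h2_bot: "((\<lambda>t. f t / t) \<longlongrightarrow> l) at_bot"
    and h3_diff: "\<And>t. f differentiable at t"
    and h3_C1: "continuous_on UNIV (deriv f)"
    and h3: "\<And>t. t \<noteq> 0 \<Longrightarrow> f t * t < deriv f t * t\<^sup>2"
    and h4_top: "filterlim (\<lambda>t. 1 / 2 * f t * t - primitive f t) at_top at_top"
    and h4_bot: "filterlim (\<lambda>t. 1 / 2 * f t * t - primitive f t) at_top at_bot"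
    and zero_notin_spectrum: "0 \<notin> ell2_spectrum (L_op \<omega>)"
    and l_notin_spectrum: "l \<notin> ell2_spectrum (L_op \<omega>)"
    and l_gt: "\<omega> < 0 \<Longrightarrow> l > - \<omega>"
    and omega_le_8: "\<omega> \<le> 8"
    and k1: "k1 > 1"
    and k2: "k2 > 1"
  shows "\<exists>u. u \<noteq> (\<lambda>_. 0) \<and> ground_state_solution_per f \<omega> k1 k2 u \<and>
           ((\<forall>t. f (- t) = - f t) \<longrightarrow>
              ground_state_solution_per f \<omega> k1 k2 (\<lambda>p. - u p) \<and>
              (\<exists>v. ground_state_solution_per f \<omega> k1 k2 v \<and> (\<forall>p. v p \<ge> 0)))"
proof -
  \<comment> \<open>Every \<open>\<omega>\<close> in \<open>[0, 8]\<close> puts 0 into the spectrum,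
    so only negative values remain.\<close>
  have \<omega>: "\<omega> < 0"
    using zero_in_spectrum_L_op[of \<omega>] zero_notin_spectrum omega_le_8 by force
  interpret periodic_dnls f \<omega> l k1 k2
    using smalloD_tendsto[OF h1] h2_top h3_diff h3 h4_top h4_bot \<omega> l_gt[OF \<omega>] k1 k2
    by unfold_locales auto
  have gss: "ground_state_solution_per f \<omega> k1 k2 w \<longleftrightarrow> ground_state_per f \<omega> k1 k2 w" for w
    using ground_state_solves by (auto simp: ground_state_solution_per_def)
  obtain u where u: "ground_state_per f \<omega> k1 k2 u" using ground_state_exists by blast
  then have "u \<noteq> (\<lambda>_. 0)" by (auto simp: ground_state_per_def is_arg_min_def Nehari_iff)
  then show ?thesis
    unfolding gss using u ground_state_uminus nonneg_ground_state_exists by blast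
qed

end
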